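(* Let $V$ be a valuation domain with valuation $v$, value group $\Gamma_v$, maximal ideal $M$ and fraction field $K$, and let $S \subseteq V$. The following are equivalent. (1) $\mathrm{Int}_K(S,V)$ is nontrivial, i.e. $\mathrm{Int}_K(S,V)\neq V[X]$. (2) There exist a finite subset $T \subseteq S$ and $\lambda \in \mathbb{Q}\Gamma_v\cup\{\infty\}$ such that $\lambda>0$ and for all $s \in S$, there exists $t \in T$ such that $v(s - t) \geq \lambda$. (3) There exist a finite subset $T \subseteq S$ and $\delta\in\Gamma_v\cup\{\infty\}$ such that $\delta>0$ and for each $s \in S$, there exists $t \in T$ such that $v(s-t) \geq \delta$. (4) There exists $b \in M$ such that $S/bV$ is finite. (5) $S$ contains neither a pseudo-divergent sequence $E$ with $\mathrm{Br}(E) = M$, nor a pseudo-stationary sequence $E$ with $\mathrm{Br}(E) = V$.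
   Context: $\mathrm{Int}_K(S,V)=\{f\in K[X]\mid f(S)\subseteq V\}$. $\mathbb{Q}\Gamma_v=\Gamma_v\otimes_{\mathbb{Z}}\mathbb{Q}$ is the divisible hull of the (additively written, totally ordered) group $\Gamma_v$, with the induced order; $v(0)=\infty$. $S/bV=\{s+bV\mid s\in S\}$ is the set of residue classes modulo $bV$ of elements of $S$ ($b=0$ is allowed). Let $\Lambda$ be an index set which is infinite and well-ordered, and let $E=\{s_i\}_{i\in\Lambda}$ be a sequence in $K$. - $E$ is pseudo-divergent if $v(s_i-s_j)>v(s_j-s_k)$ for all $i<j<k$ in $\Lambda$. In this case, for $i\in\Lambda$ put $\delta_i=v(s_i-s_j)$ with $j\in\Lambda$ and $j<i$; the breadth ideal is $\mathrm{Br}(E)=\{x\in K\mid v(x)>\delta_i\text{ for some }i\in\Lambda\}$. - $E$ is pseudo-stationary if $v(s_i-s_j)=v(s_k-s_\ell)\in\Gamma_v$ for all $i\ne j$ and $k\neq\ell$ in $\Lambda$. In this case, with $\delta=v(s_i-s_j)$ for any $i\neq j$, the breadth ideal is $\mathrm{Br}(E)=\{x\in K\mid v(x)\ge\delta\}$. $S$ contains the sequence $E$ if all $s_i$ lie in $S$.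
   Formalization: Two assumptions are added, as the claim is false without them: V is not equal to K (else S empty gives (4) but not (1)), and the index set of a pseudo-divergent sequence has no last element (else the last gauge alone can make Br(E) = M although S/bV is finite). *)

theory Defs
  imports "HOL-Computational_Algebra.Polynomial"
begin

section \<open>Adjoining infinity to an ordered group\<close>

datatype 'g with_infty = Fin 'g | Infty

instantiation with_infty :: (linorder) linorder
begin

definition less_eq_with_infty :: "'a with_infty \<Rightarrow> 'a with_infty \<Rightarrow> bool" where
  "x \<le> y \<longleftrightarrow> (case y of Infty \<Rightarrow> True | Fin b \<Rightarrow> (case x of Infty \<Rightarrow> False | Fin a \<Rightarrow> a \<le> b))"

definition less_with_infty :: "'a with_infty \<Rightarrow> 'a with_infty \<Rightarrow> bool" where
  "x < y \<longleftrightarrow> (case x of Infty \<Rightarrow> False | Fin a \<Rightarrow> (case y of Infty \<Rightarrow> True | Fin b \<Rightarrow> a < b))"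

instance
  by standard (auto simp: less_eq_with_infty_def less_with_infty_def split: with_infty.splits)

end

instantiation with_infty :: (ab_group_add) comm_monoid_add
begin

definition zero_with_infty :: "'a with_infty" where
  "0 = Fin 0"

definition plus_with_infty :: "'a with_infty \<Rightarrow> 'a with_infty \<Rightarrow> 'a with_infty" where
  "x + y = (case x of Infty \<Rightarrow> Infty | Fin a \<Rightarrow> (case y of Infty \<Rightarrow> Infty | Fin b \<Rightarrow> Fin (a + b)))"

instance
  by standard (auto simp: plus_with_infty_def zero_with_infty_def algebra_simps
      split: with_infty.splits)

end

lemma with_infty_simps [simp]:
  "Fin a \<le> Fin b \<longleftrightarrow> a \<le> b"  "x \<le> Infty"  "\<not> Infty \<le> Fin a"
  "Fin a < Fin b \<longleftrightarrow> a < b"  "Fin a < Infty"  "\<not> Infty < x"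
  by (auto simp: less_eq_with_infty_def less_with_infty_def split: with_infty.splits)

lemma with_infty_add_simps [simp]:
  "Fin a + Fin b = Fin (a + b)"  "x + Infty = Infty"  "Infty + x = Infty"
  by (auto simp: plus_with_infty_def split: with_infty.splits)


section \<open>The divisible hull of an ordered abelian group\<close>

primrec nmul :: "nat \<Rightarrow> 'g::ab_group_add \<Rightarrow> 'g" where
  "nmul 0 x = 0"
| "nmul (Suc n) x = x + nmul n x"

lemma nmul_1 [simp]: "nmul (Suc 0) x = x"
  by simp

lemma nmul_zero [simp]: "nmul n 0 = 0"
  by (induction n) auto

lemma nmul_add: "nmul n (x + y) = nmul n x + nmul n y"
  by (induction n) (auto simp: algebra_simps)

lemma nmul_add_left: "nmul (m + n) x = nmul m x + nmul n x"
  by (induction m) (auto simp: algebra_simps)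

lemma nmul_minus: "nmul n (- x) = - nmul n x"
  by (induction n) (auto simp: algebra_simps)

lemma nmul_nmul: "nmul m (nmul n x) = nmul (m * n) x"
  by (induction m) (auto simp: nmul_add_left)

lemma nmul_less:
  fixes x y :: "'g::linordered_ab_group_add"
  assumes "x < y" "0 < n" shows "nmul n x < nmul n y"
  using assms(2)
proof (induction n)
  case (Suc n)
  then show ?case using assms(1) by (cases n) (auto intro: add_strict_mono)
qed simp

lemma nmul_le_iff [simp]:
  fixes x y :: "'g::linordered_ab_group_add"
  assumes "0 < n" shows "nmul n x \<le> nmul n y \<longleftrightarrow> x \<le> y"
  by (metis assms linorder_not_le nmul_less order_le_less)

lemma nmul_eq_iff [simp]:
  fixes x y :: "'g::linordered_ab_group_add"
  assumes "0 < n" shows "nmul n x = nmul n y \<longleftrightarrow> x = y"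
  by (metis assms nmul_le_iff order_antisym order_refl)

text \<open>
  As an ordered abelian group is torsion-free, its tensor product with the rationals is the
  group of formal fractions \<open>x / n\<close> with \<open>n > 0\<close>: the pair \<open>(x, n)\<close> stands for
  \<open>x \<otimes> (1 / n)\<close>.
\<close>

definition hull_rel :: "'g::linordered_ab_group_add \<times> nat \<Rightarrow> 'g \<times> nat \<Rightarrow> bool" where
  "hull_rel p q \<longleftrightarrow> 0 < snd p \<and> 0 < snd q \<and> nmul (snd q) (fst p) = nmul (snd p) (fst q)"

lemma hull_rel_part_equivp: "part_equivp (hull_rel :: 'a::linordered_ab_group_add \<times> nat \<Rightarrow> _)"
proof (rule part_equivpI)
  show "\<exists>x::'a \<times> nat. hull_rel x x"
    by (rule exI[of _ "(0, 1)"]) (simp add: hull_rel_def)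
  show "symp (hull_rel :: 'a \<times> nat \<Rightarrow> _)"
    by (auto simp: symp_def hull_rel_def)
  show "transp (hull_rel :: 'a \<times> nat \<Rightarrow> _)"
  proof (rule transpI)
    fix p q r :: "'a \<times> nat"
    assume pq: "hull_rel p q" and qr: "hull_rel q r"
    obtain x m y n z k where [simp]: "p = (x, m)" "q = (y, n)" "r = (z, k)"
      by (cases p, cases q, cases r)
    have "nmul n (nmul k x) = nmul k (nmul n x)" by (simp add: nmul_nmul mult.commute)
    also have "\<dots> = nmul k (nmul m y)" using pq by (simp add: hull_rel_def)
    also have "\<dots> = nmul m (nmul k y)" by (simp add: nmul_nmul mult.commute)
    also have "\<dots> = nmul m (nmul n z)" using qr by (simp add: hull_rel_def)
    also have "\<dots> = nmul n (nmul m z)" by (simp add: nmul_nmul mult.commute)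
    finally show "hull_rel p r" using pq qr by (simp add: hull_rel_def)
  qed
qed

quotient_type (overloaded) 'g div_hull = "'g::linordered_ab_group_add \<times> nat" / partial: hull_rel
  by (rule hull_rel_part_equivp)

instantiation div_hull :: (linordered_ab_group_add) linordered_ab_group_add
begin

lift_definition zero_div_hull :: "'a div_hull" is "(0, 1)"
  by (simp add: hull_rel_def)

lift_definition plus_div_hull :: "'a div_hull \<Rightarrow> 'a div_hull \<Rightarrow> 'a div_hull"
  is "\<lambda>(x, m) (y, n). (nmul n x + nmul m y, m * n)"
proof (clarsimp simp: hull_rel_def nmul_add nmul_nmul)
  fix x x' y y' :: 'a and m m' n n' :: nat
  assume a: "nmul m' x = nmul m x'" "nmul n' y = nmul n y'"
  have "nmul (m' * n' * n) x = nmul (n' * n) (nmul m' x)" by (simp add: nmul_nmul ac_simps)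
  also have "\<dots> = nmul (m * n * n') x'" by (simp add: a nmul_nmul ac_simps)
  finally have 1: "nmul (m' * n' * n) x = nmul (m * n * n') x'" .
  have "nmul (m' * n' * m) y = nmul (m' * m) (nmul n' y)" by (simp add: nmul_nmul ac_simps)
  also have "\<dots> = nmul (m * n * m') y'" by (simp add: a nmul_nmul ac_simps)
  finally show "nmul (m' * n' * n) x + nmul (m' * n' * m) y
      = nmul (m * n * n') x' + nmul (m * n * m') y'" using 1 by simp
qed

lift_definition uminus_div_hull :: "'a div_hull \<Rightarrow> 'a div_hull" is "\<lambda>(x, m). (- x, m)"
  by (auto simp: hull_rel_def nmul_minus)

definition minus_div_hull :: "'a div_hull \<Rightarrow> 'a div_hull \<Rightarrow> 'a div_hull" where
  "minus_div_hull x y = x + (- y)"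

lift_definition less_eq_div_hull :: "'a div_hull \<Rightarrow> 'a div_hull \<Rightarrow> bool"
  is "\<lambda>(x, m) (y, n). nmul n x \<le> nmul m y"
proof -
  have *: "nmul n' x' \<le> nmul m' y'"
    if p: "0 < m" "0 < m'" "0 < n" "0 < n'" and a: "nmul m' x = nmul m x'" "nmul n' y = nmul n y'"
      and le: "nmul n x \<le> nmul m y"
    for x x' y y' :: 'a and m m' n n'
  proof -
    have "nmul (m * n) (nmul n' x') = nmul (n * n') (nmul m x')" by (simp add: nmul_nmul ac_simps)
    also have "\<dots> = nmul (m' * n') (nmul n x)" by (simp add: a(1)[symmetric] nmul_nmul ac_simps)
    also have "\<dots> \<le> nmul (m' * n') (nmul m y)" using p le by simp
    also have "\<dots> = nmul (m * m') (nmul n' y)" by (simp add: nmul_nmul ac_simps)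
    also have "\<dots> = nmul (m * n) (nmul m' y')" by (simp add: a nmul_nmul ac_simps)
    finally show ?thesis using p by simp
  qed
  fix p p' q q' :: "'a \<times> nat"
  assume "hull_rel p p'" "hull_rel q q'"
  obtain x m x' m' y n y' n' where
    eqs: "p = (x, m)" "p' = (x', m')" "q = (y, n)" "q' = (y', n')"
    by (cases p, cases p', cases q, cases q')
  have h: "0 < m" "0 < m'" "0 < n" "0 < n'" "nmul m' x = nmul m x'" "nmul n' y = nmul n y'"
    using \<open>hull_rel p p'\<close> \<open>hull_rel q q'\<close> unfolding eqs hull_rel_def by simp_all
  have "nmul n x \<le> nmul m y \<longleftrightarrow> nmul n' x' \<le> nmul m' y'"
    using *[OF h] *[OF h(2,1,4,3) h(5,6)[symmetric]] by (rule iffI)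
  then show "(case p of (x, m) \<Rightarrow> \<lambda>(y, n). nmul n x \<le> nmul m y) q =
      (case p' of (x, m) \<Rightarrow> \<lambda>(y, n). nmul n x \<le> nmul m y) q'"
    by (simp add: eqs)
qed

definition less_div_hull :: "'a div_hull \<Rightarrow> 'a div_hull \<Rightarrow> bool" where
  "less_div_hull x y \<longleftrightarrow> x \<le> y \<and> \<not> y \<le> x"

instance
proof
  fix a b c :: "'a div_hull"
  show "a < b \<longleftrightarrow> a \<le> b \<and> \<not> b \<le> a" by (simp add: less_div_hull_def)
  show "a \<le> a" by transfer auto
  show "a \<le> b \<or> b \<le> a" by transfer auto
  show "a \<le> b \<Longrightarrow> b \<le> a \<Longrightarrow> a = b" by transfer (auto simp: hull_rel_def)
  show "a \<le> c" if "a \<le> b" "b \<le> c"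
    using that
  proof (transfer, clarsimp simp: hull_rel_def)
    fix x y z :: 'a and m n k :: nat
    assume p: "0 < m" "0 < n" "0 < k"
      and le: "nmul n x \<le> nmul m y" "nmul k y \<le> nmul n z"
    have "nmul n (nmul k x) = nmul k (nmul n x)" by (simp add: nmul_nmul mult.commute)
    also have "\<dots> \<le> nmul k (nmul m y)" using p le by simp
    also have "\<dots> = nmul m (nmul k y)" by (simp add: nmul_nmul mult.commute)
    also have "\<dots> \<le> nmul m (nmul n z)" using p le by simp
    also have "\<dots> = nmul n (nmul m z)" by (simp add: nmul_nmul mult.commute)
    finally show "nmul k x \<le> nmul m z" using p by simp
  qed
  show "a + b + c = a + (b + c)"
    by transfer (auto simp: hull_rel_def nmul_add nmul_nmul ac_simps)
  show "a + b = b + a" by transfer (auto simp: hull_rel_def nmul_add nmul_nmul ac_simps)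
  show "0 + a = a" by transfer (auto simp: hull_rel_def nmul_add nmul_nmul ac_simps)
  show "- a + a = 0"
    by transfer (auto simp: hull_rel_def nmul_add nmul_minus nmul_nmul ac_simps)
  show "a - b = a + - b" by (simp add: minus_div_hull_def)
  show "c + a \<le> c + b" if "a \<le> b"
    using that
  proof (transfer, clarsimp simp: hull_rel_def)
    fix x y z :: 'a and m n k :: nat
    assume p: "0 < m" "0 < n" "0 < k" and le: "nmul n x \<le> nmul m y"
    have "nmul (k * k) (nmul n x) \<le> nmul (k * k) (nmul m y)" using p le by simp
    then show "nmul (k * n) (nmul m z + nmul k x) \<le> nmul (k * m) (nmul n z + nmul k y)"
      by (simp add: nmul_add nmul_nmul ac_simps)
  qed
qed

end

lift_definition to_hull :: "'g::linordered_ab_group_add \<Rightarrow> 'g div_hull" is "\<lambda>x. (x, 1)"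
  by (simp add: hull_rel_def)

lemma to_hull_le_iff: "to_hull x \<le> to_hull y \<longleftrightarrow> x \<le> y"
  by transfer simp

lemma to_hull_add: "to_hull (x + y) = to_hull x + to_hull y"
  by transfer (simp add: hull_rel_def)

lift_definition hull_frac :: "'g::linordered_ab_group_add \<Rightarrow> nat \<Rightarrow> 'g div_hull"
  is "\<lambda>x n. (x, if n = 0 then 1 else n)"
  by (simp add: hull_rel_def)

lemma hull_frac_cases:
  fixes d :: "'a::linordered_ab_group_add div_hull"
  obtains x n where "0 < n" "d = hull_frac x n"
proof -
  have "\<exists>x n. 0 < n \<and> d = hull_frac x n"
  proof transfer
    fix d :: "'a \<times> nat"
    assume "hull_rel d d"
    then show "\<exists>x n. 0 < n \<and> hull_rel d (x, if n = 0 then 1 else n)"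
      by (intro exI[of _ "fst d"] exI[of _ "snd d"]) (simp add: hull_rel_def)
  qed
  then show ?thesis using that by blast
qed

lemma nmul_hull_frac:
  assumes "0 < m" shows "nmul n (hull_frac x m) = hull_frac (nmul n x) m"
proof (induction n)
  case 0
  show ?case using assms by (simp, transfer) (simp add: hull_rel_def)
next
  case (Suc n)
  have "hull_frac x m + hull_frac (nmul n x) m = hull_frac (x + nmul n x) m"
    using assms by transfer (simp add: hull_rel_def nmul_add nmul_nmul ac_simps)
  then show ?case using Suc by simp
qed

text \<open>The hull is divisible, and every element has a positive multiple in the original group.\<close>

lemma div_hull_divisible:
  fixes d :: "'g::linordered_ab_group_add div_hull"
  assumes "0 < n" shows "\<exists>e. nmul n e = d"
proof -
  obtain x m where d: "0 < m" "d = hull_frac x m" by (rule hull_frac_cases)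
  have "hull_frac (nmul n x) (n * m) = hull_frac x m"
    using assms d(1) by transfer (simp add: hull_rel_def nmul_nmul ac_simps)
  then have "nmul n (hull_frac x (n * m)) = d" using assms d by (simp add: nmul_hull_frac)
  then show ?thesis by blast
qed

lemma div_hull_multiple:
  fixes d :: "'g::linordered_ab_group_add div_hull"
  shows "\<exists>n>0. \<exists>x. nmul n d = to_hull x"
proof -
  obtain x m where d: "0 < m" "d = hull_frac x m" by (rule hull_frac_cases)
  have "hull_frac (nmul m x) m = to_hull x"
    using d(1) by transfer (simp add: hull_rel_def)
  then show ?thesis using d by (intro exI[of _ m] exI[of _ x] conjI) (simp_all add: nmul_hull_frac)
qed


section \<open>Valuations\<close>

text \<open>
  The field \<open>K\<close> is the type \<open>'k\<close>.  Surjectivity makes \<open>'g\<close> the value group of \<open>v\<close>.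
\<close>

definition valuation :: "('k::field \<Rightarrow> 'g::linordered_ab_group_add with_infty) \<Rightarrow> bool" where
  "valuation v \<longleftrightarrow>
     (\<forall>x. v x = Infty \<longleftrightarrow> x = 0) \<and>
     (\<forall>x y. v (x * y) = v x + v y) \<and>
     (\<forall>x y. min (v x) (v y) \<le> v (x + y)) \<and>
     range v = UNIV"

definition valuation_ring :: "('k::field \<Rightarrow> 'g::linordered_ab_group_add with_infty) \<Rightarrow> 'k set" where
  "valuation_ring v = {x. 0 \<le> v x}"

definition maximal_ideal :: "('k::field \<Rightarrow> 'g::linordered_ab_group_add with_infty) \<Rightarrow> 'k set" where
  "maximal_ideal v = {x. 0 < v x}"

lemma valuation_one:
  assumes "valuation v" shows "v 1 = 0"
proof -
  have "v 1 \<noteq> Infty" and "v 1 = v 1 + v 1"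
    using assms unfolding valuation_def by (metis zero_neq_one, metis mult_1)
  then show ?thesis by (cases "v 1") (auto simp: zero_with_infty_def)
qed

lemma valuation_zero: "valuation v \<Longrightarrow> v 0 = Infty"
  by (simp add: valuation_def)

lemma valuation_uminus:
  assumes "valuation v" shows "v (- x) = v x"
proof -
  have m: "v (x * y) = v x + v y" for x y using assms by (simp add: valuation_def)
  have "v (- 1) + v (- 1) = 0" using m[of "- 1" "- 1"] valuation_one[OF assms] by simp
  then have "v (- 1) = 0"
    by (cases "v (- 1)") (auto simp: zero_with_infty_def)
  then show ?thesis using m[of "- 1" x] by simp
qed

lemma valuation_ring_subring:
  assumes "valuation v"
  shows "1 \<in> valuation_ring v"
    and "x \<in> valuation_ring v \<Longrightarrow> y \<in> valuation_ring v \<Longrightarrow> x - y \<in> valuation_ring v"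
    and "x \<in> valuation_ring v \<Longrightarrow> y \<in> valuation_ring v \<Longrightarrow> x * y \<in> valuation_ring v"
proof -
  show "1 \<in> valuation_ring v" using valuation_one[OF assms] by (simp add: valuation_ring_def)
  assume xy: "x \<in> valuation_ring v" "y \<in> valuation_ring v"
  have "min (v x) (v (- y)) \<le> v (x + - y)" using assms unfolding valuation_def by blast
  then show "x - y \<in> valuation_ring v" using xy
    by (auto simp: valuation_ring_def valuation_uminus[OF assms] min_def split: if_splits
        intro: order_trans)
  have "v (x * y) = v x + v y" using assms unfolding valuation_def by blast
  then show "x * y \<in> valuation_ring v" using xy
    by (cases "v x"; cases "v y") (auto simp: valuation_ring_def zero_with_infty_def)
qed

lemma valuation_inverse:
  assumes "valuation v" "x \<noteq> 0" shows "v x + v (inverse x) = 0"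
  using assms valuation_one[OF assms(1)] unfolding valuation_def by (metis right_inverse)

lemma valuation_ring_or_inverse:
  assumes "valuation v" shows "x \<in> valuation_ring v \<or> inverse x \<in> valuation_ring v"
proof (cases "x = 0")
  case True
  then show ?thesis using valuation_zero[OF assms] by (simp add: valuation_ring_def)
next
  case False
  from valuation_inverse[OF assms this] show ?thesis
    by (cases "v x"; cases "v (inverse x)")
      (auto simp: valuation_ring_def zero_with_infty_def add_eq_0_iff)
qed

lemma maximal_ideal_nonunits:
  assumes "valuation v"
  shows "maximal_ideal v = {x \<in> valuation_ring v. \<not> (\<exists>y \<in> valuation_ring v. x * y = 1)}"
proof -
  have "0 < v x \<longleftrightarrow> 0 \<le> v x \<and> \<not> (\<exists>y. 0 \<le> v y \<and> x * y = 1)" for x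
  proof (cases "x = 0")
    case True
    then show ?thesis using valuation_zero[OF assms] by (simp add: zero_with_infty_def)
  next
    case False
    then have "x * y = 1 \<longleftrightarrow> y = inverse x" for y
      by (metis inverse_unique right_inverse)
    with valuation_inverse[OF assms False] show ?thesis
      by (cases "v x"; cases "v (inverse x)") (auto simp: zero_with_infty_def add_eq_0_iff)
  qed
  then show ?thesis by (auto simp: maximal_ideal_def valuation_ring_def)
qed


section \<open>Integer-valued polynomials and residue classes\<close>

definition Int_poly :: "'k::field set \<Rightarrow> 'k set \<Rightarrow> 'k poly set" where
  "Int_poly S V = {f. \<forall>s\<in>S. poly f s \<in> V}"

definition polys_over :: "'k::field set \<Rightarrow> 'k poly set" where
  "polys_over V = {f. \<forall>i. coeff f i \<in> V}"

definition residue_classes :: "'k::field set \<Rightarrow> 'k \<Rightarrow> 'k set \<Rightarrow> 'k set set" where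
  "residue_classes S b V = {{s + b * x | x. x \<in> V} | s. s \<in> S}"


section \<open>Pseudo-divergent and pseudo-stationary sequences\<close>

text \<open>
  The index set is \<open>Field r\<close>, well-ordered by the (reflexive) relation \<open>r\<close>.
\<close>

definition index_less :: "'i rel \<Rightarrow> 'i \<Rightarrow> 'i \<Rightarrow> bool" where
  "index_less r i j \<longleftrightarrow> (i, j) \<in> r \<and> i \<noteq> j"

text \<open>
  As is usual for such sequences, the index set of a pseudo-divergent sequence has no last
  element.  With a last element \<open>l\<close>, the value \<open>\<delta>\<^sub>l\<close> could be any element of the group lying
  below all the other \<open>\<delta>\<^sub>i\<close>, so the breadth ideal would say nothing about the rest of the
  sequence.
\<close>

definition pseudo_divergent ::
  "('k::field \<Rightarrow> 'g::linordered_ab_group_add with_infty) \<Rightarrow> 'i rel \<Rightarrow> ('i \<Rightarrow> 'k) \<Rightarrow> bool" where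
  "pseudo_divergent v r s \<longleftrightarrow>
     Well_order r \<and> infinite (Field r) \<and> (\<forall>i\<in>Field r. \<exists>j. index_less r i j) \<and>
     (\<forall>i j k. index_less r i j \<and> index_less r j k \<longrightarrow> v (s i - s j) > v (s j - s k))"

text \<open>
  \<open>\<delta>\<^sub>i = v (s\<^sub>i - s\<^sub>j)\<close> for \<open>j < i\<close> does not depend on \<open>j\<close>
  (lemma \<open>pseudo_divergent_gauge\<close> below); it is defined for every \<open>i\<close> but the least one.
\<close>

definition breadth_divergent ::
  "('k::field \<Rightarrow> 'g::linordered_ab_group_add with_infty) \<Rightarrow> 'i rel \<Rightarrow> ('i \<Rightarrow> 'k) \<Rightarrow> 'k set" where
  "breadth_divergent v r s = {x. \<exists>i j. index_less r j i \<and> v x > v (s i - s j)}"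

definition pseudo_stationary ::
  "('k::field \<Rightarrow> 'g::linordered_ab_group_add with_infty) \<Rightarrow> 'i rel \<Rightarrow> ('i \<Rightarrow> 'k) \<Rightarrow> bool" where
  "pseudo_stationary v r s \<longleftrightarrow>
     Well_order r \<and> infinite (Field r) \<and>
     (\<forall>i\<in>Field r. \<forall>j\<in>Field r. \<forall>k\<in>Field r. \<forall>l\<in>Field r. i \<noteq> j \<and> k \<noteq> l \<longrightarrow>
        v (s i - s j) = v (s k - s l) \<and> v (s i - s j) \<noteq> Infty)"

definition breadth_stationary ::
  "('k::field \<Rightarrow> 'g::linordered_ab_group_add with_infty) \<Rightarrow> 'i rel \<Rightarrow> ('i \<Rightarrow> 'k) \<Rightarrow> 'k set" where
  "breadth_stationary v r s =
     {x. \<exists>i\<in>Field r. \<exists>j\<in>Field r. i \<noteq> j \<and> v x \<ge> v (s i - s j)}"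

text \<open>
  "\<open>S\<close> contains such a sequence" quantifies over index sets.  Inside a formula the index set
  has to live in a fixed type, for which \<open>'k\<close> itself is large enough: the lemmas
  \<open>contains_divergentI\<close> and \<open>contains_stationaryI\<close> below show that a sequence over any index
  type can be reindexed.
\<close>

definition contains_divergent ::
  "('k::field \<Rightarrow> 'g::linordered_ab_group_add with_infty) \<Rightarrow> 'k set \<Rightarrow> 'k set \<Rightarrow> bool" where
  "contains_divergent v S B \<longleftrightarrow>
     (\<exists>(r :: 'k rel) s. pseudo_divergent v r s \<and> s ` Field r \<subseteq> S \<and> breadth_divergent v r s = B)"

definition contains_stationary ::
  "('k::field \<Rightarrow> 'g::linordered_ab_group_add with_infty) \<Rightarrow> 'k set \<Rightarrow> 'k set \<Rightarrow> bool" where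
  "contains_stationary v S B \<longleftrightarrow>
     (\<exists>(r :: 'k rel) s. pseudo_stationary v r s \<and> s ` Field r \<subseteq> S \<and> breadth_stationary v r s = B)"

lemma valuation_minus_commute:
  assumes "valuation v" shows "v (x - y) = v (y - x)"
  using valuation_uminus[OF assms, of "x - y"] by simp

lemma index_lessD: "index_less r i j \<Longrightarrow> i \<in> Field r \<and> j \<in> Field r"
  by (auto simp: index_less_def Field_def)

lemma Well_order_trichotomy:
  assumes "Well_order r" "i \<in> Field r" "j \<in> Field r" "i \<noteq> j"
  shows "index_less r i j \<or> index_less r j i"
  using assms
  by (auto simp: well_order_on_def linear_order_on_def total_on_def index_less_def)

lemma valuation_add_larger:
  assumes "valuation v" "v y < v x" shows "v (x + y) = v y"
proof (rule antisym)
  have m: "min (v a) (v b) \<le> v (a + b)" for a b using assms unfolding valuation_def by blast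
  show "v y \<le> v (x + y)" using m[of x y] assms(2) by simp
  have "min (v (x + y)) (v x) \<le> v y"
    using m[of "x + y" "- x"] valuation_uminus[OF assms(1)] by simp
  then show "v (x + y) \<le> v y" using assms(2) by (auto simp: min_def split: if_splits)
qed

lemma pseudo_divergent_gauge:
  assumes "valuation v" "pseudo_divergent v r s" "index_less r j i" "index_less r j' i"
  shows "v (s i - s j) = v (s i - s j')"
proof -
  have *: "v (s i - s j) = v (s i - s j')" if "index_less r j j'" "index_less r j' i" for j j'
  proof -
    have "v (s j' - s i) < v (s j - s j')" using assms(2) that by (auto simp: pseudo_divergent_def)
    then have "v ((s j - s j') + (s j' - s i)) = v (s j' - s i)"
      by (rule valuation_add_larger[OF assms(1)])
    then show ?thesis by (simp add: valuation_minus_commute[OF assms(1), of "s i"])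
  qed
  have "Well_order r" using assms(2) by (simp add: pseudo_divergent_def)
  then have "j = j' \<or> index_less r j j' \<or> index_less r j' j"
    using Well_order_trichotomy index_lessD assms(3,4) by metis
  then show ?thesis using * assms(3,4) by metis
qed

lemma index_less_dir_image:
  assumes "inj_on g (Field r)" "i \<in> Field r" "j \<in> Field r"
  shows "index_less (dir_image r g) (g i) (g j) \<longleftrightarrow> index_less r i j"
proof -
  have "(g i, g j) \<in> dir_image r g \<longleftrightarrow> (i, j) \<in> r"
  proof
    assume "(g i, g j) \<in> dir_image r g"
    then obtain a b where "g i = g a" "g j = g b" "(a, b) \<in> r" by (auto simp: dir_image_def)
    moreover from this have "a \<in> Field r" "b \<in> Field r" by (auto simp: Field_def)
    ultimately show "(i, j) \<in> r" using assms by (auto simp: inj_on_def)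
  qed (auto simp: dir_image_def)
  then show ?thesis using assms by (auto simp: index_less_def inj_on_def)
qed

lemma contains_divergentI:
  fixes r :: "'i rel" and v :: "'k::field \<Rightarrow> 'g::linordered_ab_group_add with_infty"
  assumes v: "valuation v" and E: "pseudo_divergent v r s" and S: "s ` Field r \<subseteq> S"
  shows "contains_divergent v S (breadth_divergent v r s)"
proof -
  have wo: "Well_order r" and inf: "infinite (Field r)"
    using E by (auto simp: pseudo_divergent_def)
  define F where "F = {j \<in> Field r. \<exists>i. index_less r i j}"
  have inj: "inj_on s F"
  proof (rule inj_onI, rule ccontr)
    have *: False if jk: "index_less r j k" "j \<in> F" "s j = s k" for j k
    proof -
      obtain i where "index_less r i j" using jk(2) by (auto simp: F_def)
      then have "v (s j - s k) < v (s i - s j)" using E jk(1) by (auto simp: pseudo_divergent_def)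
      moreover have "v (s j - s k) = Infty" using v jk(3) by (simp add: valuation_def)
      ultimately show False by simp
    qed
    fix j k assume "j \<in> F" "k \<in> F" "s j = s k" "j \<noteq> k"
    then show False
      using *[of j k] *[of k j] Well_order_trichotomy[OF wo, of j k] by (auto simp: F_def)
  qed
  have "Field r - F \<subseteq> {m}" if "m \<in> Field r - F" for m
    using that Well_order_trichotomy[OF wo] by (auto simp: F_def)
  then obtain m where m: "Field r - F \<subseteq> {m}" by blast
  obtain h where "bij_betw h (Field r) (Field r - {m})"
    using infinite_imp_bij_betw[OF inf] by blast
  then have h: "inj_on h (Field r)" "h ` Field r \<subseteq> F"
    using m by (auto simp: bij_betw_def)
  define g where "g = s \<circ> h"
  have g: "inj_on g (Field r)"
    unfolding g_def using h inj by (auto intro: comp_inj_on inj_on_subset)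
  define r' where "r' = dir_image r g"
  define s' where "s' = s \<circ> inv_into (Field r) g"
  have s': "s' (g i) = s i" if "i \<in> Field r" for i
    using g that by (simp add: s'_def)
  have F': "Field r' = g ` Field r" by (simp add: r'_def dir_image_Field)
  have less: "index_less r' (g i) (g j) \<longleftrightarrow> index_less r i j"
    if "i \<in> Field r" "j \<in> Field r" for i j
    unfolding r'_def using g that by (rule index_less_dir_image)
  have "pseudo_divergent v r' s'"
    unfolding pseudo_divergent_def
  proof (intro conjI allI impI ballI)
    show "Well_order r'" unfolding r'_def using wo g by (rule Well_order_dir_image)
    show "infinite (Field r')" unfolding F' using inf g by (simp add: finite_image_iff)
    show "\<exists>j. index_less r' i j" if "i \<in> Field r'" for i
      using that E less index_lessD unfolding F' pseudo_divergent_def by (metis imageE)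
    show "v (s' j - s' k) < v (s' i - s' j)"
      if "index_less r' i j \<and> index_less r' j k" for i j k
    proof -
      from that have "{i, j, k} \<subseteq> Field r'" by (auto dest: index_lessD)
      then obtain a b c where "i = g a" "j = g b" "k = g c" "{a, b, c} \<subseteq> Field r"
        unfolding F' by auto
      then show ?thesis using that E less s' by (auto simp: pseudo_divergent_def)
    qed
  qed
  moreover have "s' ` Field r' \<subseteq> S" using S s' by (auto simp: F')
  moreover have "breadth_divergent v r' s' = breadth_divergent v r s"
  proof -
    have "(\<exists>i j. index_less r' j i \<and> v x > v (s' i - s' j)) \<longleftrightarrow>
        (\<exists>i j. index_less r j i \<and> v x > v (s i - s j))" for x
    proof
      assume "\<exists>i j. index_less r' j i \<and> v x > v (s' i - s' j)"
      then obtain i j where ij: "index_less r' j i" "v x > v (s' i - s' j)" by blast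
      then have "i \<in> Field r'" "j \<in> Field r'" by (auto dest: index_lessD)
      then obtain a b where "i = g a" "j = g b" "a \<in> Field r" "b \<in> Field r" unfolding F' by auto
      then show "\<exists>i j. index_less r j i \<and> v x > v (s i - s j)" using ij less s' by metis
    next
      assume "\<exists>i j. index_less r j i \<and> v x > v (s i - s j)"
      then show "\<exists>i j. index_less r' j i \<and> v x > v (s' i - s' j)"
        using less s' index_lessD by metis
    qed
    then show ?thesis by (simp add: breadth_divergent_def)
  qed
  ultimately show ?thesis unfolding contains_divergent_def by blast
qed

lemma contains_stationaryI:
  fixes r :: "'i rel" and v :: "'k::field \<Rightarrow> 'g::linordered_ab_group_add with_infty"
  assumes v: "valuation v" and E: "pseudo_stationary v r s" and S: "s ` Field r \<subseteq> S"
  shows "contains_stationary v S (breadth_stationary v r s)"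
proof -
  have wo: "Well_order r" and inf: "infinite (Field r)"
    using E by (auto simp: pseudo_stationary_def)
  have g: "inj_on s (Field r)"
  proof (rule inj_onI, rule ccontr)
    fix i j assume ij: "i \<in> Field r" "j \<in> Field r" "s i = s j" "i \<noteq> j"
    then have "v (s i - s j) \<noteq> Infty" using E unfolding pseudo_stationary_def by blast
    then show False using ij v by (simp add: valuation_def)
  qed
  have F': "Field (dir_image r s) = s ` Field r" by (simp add: dir_image_Field)
  have ne: "s i \<noteq> s j \<longleftrightarrow> i \<noteq> j" if "i \<in> Field r" "j \<in> Field r" for i j
    using g that by (auto simp: inj_on_def)
  have "pseudo_stationary v (dir_image r s) id"
    unfolding pseudo_stationary_def
  proof (intro conjI)
    show "Well_order (dir_image r s)" using wo g by (rule Well_order_dir_image)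
    show "infinite (Field (dir_image r s))" unfolding F' using inf g by (simp add: finite_image_iff)
    show "\<forall>i\<in>Field (dir_image r s). \<forall>j\<in>Field (dir_image r s). \<forall>k\<in>Field (dir_image r s).
        \<forall>l\<in>Field (dir_image r s). i \<noteq> j \<and> k \<noteq> l \<longrightarrow>
        v (id i - id j) = v (id k - id l) \<and> v (id i - id j) \<noteq> Infty"
      unfolding F' using E by (simp add: pseudo_stationary_def) metis
  qed
  moreover have "id ` Field (dir_image r s) \<subseteq> S" using S by (simp add: F')
  moreover have "breadth_stationary v (dir_image r s) id = breadth_stationary v r s"
    unfolding breadth_stationary_def F' using ne by simp
  ultimately show ?thesis unfolding contains_stationary_def by blast
qed

end

theory Submission
  imports Defs
begin

text \<open>
  Condition (3) is the hub.  Read \<open>v (s - t) \<ge> \<delta>\<close> as ``\<open>s\<close> and \<open>t\<close> are \<open>\<delta>\<close>-close'': (3) says that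
  for some \<open>\<delta> > 0\<close> the set \<open>S\<close> has a finite \<open>\<delta>\<close>-net, and (4) says the same in terms of the classes
  modulo an element \<open>b\<close> of value \<open>\<delta>\<close>.

  If \<open>T\<close> is a finite net, then \<open>(\<Prod>t\<in>T. X - t) / c\<close> with \<open>0 < v c \<le> \<delta>\<close> is integer-valued on \<open>S\<close>,
  since at each \<open>s\<close> one factor has value at least \<open>\<delta>\<close>; its leading coefficient \<open>1 / c\<close> is not in
  \<open>V\<close>.  Conversely, Newton interpolation bounds the denominators of an integer-valued polynomial
  of degree less than \<open>N\<close> by the values of the differences of \<open>N\<close> points of \<open>S\<close>
  (\<open>interpolation_denominator\<close>).  If some coefficient has value \<open>- \<gamma> < 0\<close>, then \<open>S\<close> cannot contain
  \<open>N\<close> points whose differences all have value less than \<open>\<gamma> / N\<close>, so a largest set of points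
  separated in this sense is a finite net for \<open>\<lambda> = \<gamma> / N\<close>, which is (2).  The number \<open>\<lambda>\<close> need
  not lie in the value group, but below every positive element of the hull there is a \<open>\<delta> > 0\<close>
  in the value group, unless the group has a least positive element \<open>\<delta>\<close>, and then \<open>v x \<ge> \<lambda>\<close>
  already implies \<open>v x \<ge> \<delta>\<close> (\<open>hull_threshold\<close>).

  A finite net rules out both kinds of sequences by the pigeonhole principle.  If there is no
  finite net, then either \<open>S\<close> meets infinitely many classes modulo \<open>M\<close>, and representatives of
  these form a pseudo-stationary sequence, or finitely many classes \<open>t + M\<close> cover \<open>S\<close>, and for one of
  these \<open>t\<close> the positive values \<open>v (s - t)\<close> with \<open>s \<in> S\<close> come arbitrarily close to \<open>0\<close>.  Elements
  \<open>s\<close> along which \<open>v (s - t)\<close> decreases to \<open>0\<close> then form a pseudo-divergent sequence.  The value group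
  may have uncountable cofinality, so this sequence is not chosen step by step; it consists
  of the record-breaking elements with respect to an arbitrary well-order
  (\<open>contains_divergent_of_values_near_zero\<close>).
\<close>

section \<open>Elements of the divisible hull as thresholds\<close>

lemma to_hull_zero: "to_hull 0 = 0"
  by transfer (simp add: hull_rel_def)

lemma hull_frac_le_to_hull:
  assumes "0 < n" shows "hull_frac x n \<le> to_hull y \<longleftrightarrow> x \<le> nmul n y"
  using assms by transfer simp

lemma hull_frac_pos:
  assumes "0 < n" shows "0 < hull_frac x n \<longleftrightarrow> 0 < x"
proof -
  have "hull_frac x n \<le> 0 \<longleftrightarrow> x \<le> 0"
    using hull_frac_le_to_hull[OF assms, of x 0] by (simp add: to_hull_zero)
  then show ?thesis by (simp add: not_le[symmetric])
qed

lemma nmul_mono_left: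
  fixes x :: "'g::linordered_ab_group_add"
  assumes "m \<le> n" "0 \<le> x" shows "nmul m x \<le> nmul n x"
  using assms(1)
proof (induction rule: dec_induct)
  case (step k)
  then show ?case using assms(2) by (simp add: add_increasing)
qed simp

lemma exists_small_multiple:
  fixes g :: "'g::linordered_ab_group_add"
  assumes dense: "\<And>x::'g. 0 < x \<Longrightarrow> \<exists>y. 0 < y \<and> y < x" and "0 < g"
  shows "\<exists>d>0. nmul n d \<le> g"
proof (induction n)
  case 0
  show ?case using \<open>0 < g\<close> by auto
next
  case (Suc n)
  then obtain d where d: "0 < d" "nmul n d \<le> g" by blast
  show ?case
  proof (cases "n = 0")
    case True
    then show ?thesis using \<open>0 < g\<close> by auto
  next
    case False
    obtain y where y: "0 < y" "y < d" using dense d(1) by blast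
    \<comment> \<open>of two positive numbers with sum \<open>d\<close>, the smaller one is at most a half of \<open>d\<close>\<close>
    define e where "e = min y (d - y)"
    have e: "0 < e" "e + e \<le> d"
      using y add_mono[of e y e "d - y"] by (auto simp: e_def)
    have "nmul (Suc n) e \<le> nmul (n + n) e"
      using False e(1) by (intro nmul_mono_left) auto
    also have "\<dots> = nmul n (e + e)" by (simp add: nmul_add nmul_add_left)
    also have "\<dots> \<le> nmul n d" using False e(2) by simp
    finally show ?thesis using e(1) d(2) by (auto intro: order_trans)
  qed
qed

text \<open>
  A finite \<open>l\<close> has the form \<open>g / n\<close>.  If the group has no least positive element, some \<open>d > 0\<close> satisfies \<open>n d \<le> g\<close>,
  hence \<open>d \<le> l\<close>; if it has one, every positive element of the group is at least this one.
\<close>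

lemma hull_threshold:
  fixes l :: "'g::linordered_ab_group_add div_hull with_infty"
  assumes "0 < l"
  shows "\<exists>d::'g with_infty. 0 < d \<and> (\<forall>x. l \<le> map_with_infty to_hull x \<longrightarrow> d \<le> x)"
proof (cases l)
  case Infty
  then have "\<forall>x::'g with_infty. l \<le> map_with_infty to_hull x \<longrightarrow> Infty \<le> x"
    by (auto simp: less_eq_with_infty_def split: with_infty.splits)
  then show ?thesis by (metis with_infty_simps(5) zero_with_infty_def)
next
  case (Fin q)
  then have q: "0 < q" using assms by (simp add: zero_with_infty_def)
  obtain g n where n: "0 < n" and qgn: "q = hull_frac g n" by (rule hull_frac_cases)
  have g: "0 < g" using q n qgn by (simp add: hull_frac_pos)
  have thr: ?thesis if d: "0 < d" "\<And>y. g \<le> nmul n y \<Longrightarrow> d \<le> y" for d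
  proof (intro exI conjI allI impI)
    show "0 < Fin d" using d(1) by (simp add: zero_with_infty_def)
    show "Fin d \<le> x" if "l \<le> map_with_infty to_hull x" for x
      using that d(2) n by (cases x) (auto simp: Fin qgn hull_frac_le_to_hull)
  qed
  show ?thesis
  proof (cases "\<forall>x::'g. 0 < x \<longrightarrow> (\<exists>y. 0 < y \<and> y < x)")
    case True
    then obtain d where d: "0 < d" "nmul n d \<le> g"
      using exists_small_multiple[OF _ g, of n] by blast
    then show ?thesis using n by (intro thr[of d]) (auto dest: order_trans)
  next
    case False
    then obtain d :: 'g where d: "0 < d" "\<And>y. 0 < y \<Longrightarrow> d \<le> y" by (metis not_le)
    have "d \<le> y" if "g \<le> nmul n y" for y
    proof (rule d(2), rule ccontr)
      assume "\<not> 0 < y"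
      then have "nmul n y \<le> nmul n 0" using n by (metis nmul_le_iff not_le)
      then show False using that g by simp
    qed
    then show ?thesis using d(1) by (intro thr)
  qed
qed


section \<open>Closeness with respect to a valuation\<close>

context
  fixes v :: "'k::field \<Rightarrow> 'g::linordered_ab_group_add with_infty"
  assumes val: "valuation v"
begin

lemma val_mult: "v (x * y) = v x + v y"
  using val by (simp add: valuation_def)

lemma val_eq_Infty_iff: "v x = Infty \<longleftrightarrow> x = 0"
  using val by (simp add: valuation_def)

lemma val_surj: "\<exists>x. v x = d"
  using val unfolding valuation_def by (metis UNIV_I imageE)

lemma val_ultrametric: "d \<le> v x \<Longrightarrow> d \<le> v y \<Longrightarrow> d \<le> v (x + y)"
  using val unfolding valuation_def by (metis min.boundedI order_trans)

lemma val_diff_trans: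
  assumes "d \<le> v (x - y)" "d \<le> v (y - z)" shows "d \<le> v (x - z)"
  using val_ultrametric[OF assms] by simp

lemma val_diff_trans_less:
  assumes "d < v (x - y)" "d < v (y - z)" shows "d < v (x - z)"
proof -
  have "d < min (v (x - y)) (v (y - z))" using assms by simp
  also have "\<dots> \<le> v (x - z)" by (rule val_diff_trans[of _ x y]) auto
  finally show ?thesis .
qed

lemma val_divide_in_ring:
  assumes "y \<noteq> 0" "v y \<le> v x" shows "x / y \<in> valuation_ring v"
proof -
  have "v (inverse y) + v y \<le> v (inverse y) + v x"
    using assms(2) by (cases "v x"; cases "v y"; cases "v (inverse y)") auto
  then show ?thesis using valuation_inverse[OF val assms(1)]
    by (simp add: valuation_ring_def divide_inverse val_mult add.commute)
qed

lemma val_power_Fin: "v x = Fin d \<Longrightarrow> v (x ^ n) = Fin (nmul n d)"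
  by (induction n) (simp_all add: valuation_one[OF val] zero_with_infty_def val_mult)

lemma ring_zero: "0 \<in> valuation_ring v"
  using valuation_zero[OF val] by (simp add: valuation_ring_def)

lemma ring_add: "x \<in> valuation_ring v \<Longrightarrow> y \<in> valuation_ring v \<Longrightarrow> x + y \<in> valuation_ring v"
  by (simp add: valuation_ring_def val_ultrametric)

lemma ring_power: "x \<in> valuation_ring v \<Longrightarrow> x ^ n \<in> valuation_ring v"
  by (induction n) (auto intro: valuation_ring_subring[OF val])

lemma ring_prod:
  "(\<And>t. t \<in> T \<Longrightarrow> h t \<in> valuation_ring v) \<Longrightarrow> (\<Prod>t\<in>T. h t) \<in> valuation_ring v"
  by (induction T rule: infinite_finite_induct) (auto intro: valuation_ring_subring[OF val])

lemma polys_over_add: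
  "p \<in> polys_over (valuation_ring v) \<Longrightarrow> q \<in> polys_over (valuation_ring v) \<Longrightarrow>
    p + q \<in> polys_over (valuation_ring v)"
  by (simp add: polys_over_def ring_add)

lemma polys_over_smult:
  "a \<in> valuation_ring v \<Longrightarrow> p \<in> polys_over (valuation_ring v) \<Longrightarrow>
    smult a p \<in> polys_over (valuation_ring v)"
  by (simp add: polys_over_def valuation_ring_subring[OF val])

lemma polys_over_pCons:
  "a \<in> valuation_ring v \<Longrightarrow> p \<in> polys_over (valuation_ring v) \<Longrightarrow>
    pCons a p \<in> polys_over (valuation_ring v)"
  by (auto simp: polys_over_def coeff_pCons split: nat.splits)

lemma polys_over_eval:
  "p \<in> polys_over (valuation_ring v) \<Longrightarrow> x \<in> valuation_ring v \<Longrightarrow>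
    poly p x \<in> valuation_ring v"
proof (induction p)
  case (pCons a p)
  have "a \<in> valuation_ring v" "p \<in> polys_over (valuation_ring v)"
    using pCons.prems(1) unfolding polys_over_def
    by (auto simp: coeff_pCons split: nat.splits dest: spec[of _ 0] spec[of _ "Suc _"])
  then show ?case using pCons by (simp add: ring_add valuation_ring_subring[OF val])
qed (simp add: ring_zero)


section \<open>Integer-valued polynomials and finite nets\<close>

text \<open>
  Newton interpolation: write \<open>f = f a + (X - a) g\<close>.  For the other nodes \<open>b\<close>, the value
  \<open>g b = (f b - f a) / (b - a)\<close> becomes integral after multiplication by \<open>c\<close>, so the induction
  hypothesis applies to \<open>c g\<close>.
\<close>

lemma interpolation_denominator:
  assumes "finite A" "A \<subseteq> valuation_ring v" "c \<in> valuation_ring v"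
    and "\<And>a b. a \<in> A \<Longrightarrow> b \<in> A \<Longrightarrow> a \<noteq> b \<Longrightarrow> v (a - b) \<le> v c"
    and "\<And>a. a \<in> A \<Longrightarrow> poly f a \<in> valuation_ring v"
    and "f = 0 \<or> degree f < card A"
  shows "smult (c ^ card A) f \<in> polys_over (valuation_ring v)"
  using assms
proof (induction A arbitrary: f rule: finite_induct)
  case empty
  then show ?case by (simp add: polys_over_def ring_zero)
next
  case (insert a B)
  define g where "g = synthetic_div f a"
  have f: "f = [:poly f a:] + [:- a, 1:] * g"
    using synthetic_div_correct'[of a f] unfolding g_def by (simp only: add.commute)
  have "smult (c ^ card B) (smult c g) \<in> polys_over (valuation_ring v)"
  proof (rule insert.IH)
    show "poly (smult c g) b \<in> valuation_ring v" if "b \<in> B" for b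
    proof -
      have ne: "b - a \<noteq> 0" using that insert.hyps(2) by auto
      have "poly f b = poly f a + (b - a) * poly g b" by (subst f) (simp add: algebra_simps)
      then have "poly (smult c g) b = c / (b - a) * (poly f b - poly f a)"
        using ne by simp
      also have "\<dots> \<in> valuation_ring v"
      proof (intro valuation_ring_subring[OF val] val_divide_in_ring ne)
        show "v (b - a) \<le> v c" using that ne by (intro insert.prems(3)) auto
      qed (use that insert.prems(4) in auto)
      finally show ?thesis .
    qed
    show "smult c g = 0 \<or> degree (smult c g) < card B"
    proof (cases "degree f = 0")
      case True
      then show ?thesis by (simp add: g_def synthetic_div_eq_0_iff)
    next
      case False
      then have "degree f < Suc (card B)" using insert.prems(5) insert.hyps by auto
      then show ?thesis using False degree_smult_le[of c g] by (auto simp: g_def degree_synthetic_div)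
    qed
  qed (use insert.prems in auto)
  then have g: "smult (c ^ Suc (card B)) g \<in> polys_over (valuation_ring v)"
    by (simp add: mult.commute)
  have "smult (c ^ Suc (card B)) f = smult (c ^ Suc (card B)) [:poly f a:]
      + (pCons 0 (smult (c ^ Suc (card B)) g) + smult (- a) (smult (c ^ Suc (card B)) g))"
    by (subst f) (simp add: smult_add_right smult_diff_right mult.commute)
  also have "\<dots> \<in> polys_over (valuation_ring v)"
  proof (intro polys_over_add)
    have a: "- a \<in> valuation_ring v" and fa: "poly f a \<in> valuation_ring v"
      using insert.prems by (auto simp: valuation_ring_def valuation_uminus[OF val])
    have "[:poly f a:] \<in> polys_over (valuation_ring v)"
      using fa by (intro polys_over_pCons) (simp_all add: polys_over_def ring_zero)
    then show "smult (c ^ Suc (card B)) [:poly f a:] \<in> polys_over (valuation_ring v)"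
      by (intro polys_over_smult ring_power insert.prems(2))
    show "pCons 0 (smult (c ^ Suc (card B)) g) \<in> polys_over (valuation_ring v)"
      by (intro polys_over_pCons ring_zero g)
    show "smult (- a) (smult (c ^ Suc (card B)) g) \<in> polys_over (valuation_ring v)"
      by (intro polys_over_smult a g)
  qed
  finally show ?case using insert.hyps by simp
qed

lemma finite_net_of_bounded_separated_sets:
  assumes refl: "\<And>s. s \<in> S \<Longrightarrow> R s s" and sym: "\<And>s t. R s t \<Longrightarrow> R t s"
    and bound: "\<And>A. finite A \<Longrightarrow> A \<subseteq> S \<Longrightarrow> pairwise (\<lambda>a b. \<not> R a b) A \<Longrightarrow> card A < N"
  shows "\<exists>T. finite T \<and> T \<subseteq> S \<and> (\<forall>s\<in>S. \<exists>t\<in>T. R s t)"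
proof -
  define P where "P A \<longleftrightarrow> finite A \<and> A \<subseteq> S \<and> pairwise (\<lambda>a b. \<not> R a b) A" for A
  have "P {}" by (simp add: P_def)
  then obtain T where T: "P T" and max: "\<And>A. P A \<Longrightarrow> card A \<le> card T"
    using ex_has_greatest_nat[of P "{}" card N] bound unfolding P_def by metis
  have "\<exists>t\<in>T. R s t" if "s \<in> S" for s
  proof (rule ccontr)
    assume *: "\<not> (\<exists>t\<in>T. R s t)"
    then have "s \<notin> T" using refl that by blast
    moreover have "P (insert s T)"
      using T that * sym unfolding P_def by (auto simp: pairwise_insert)
    ultimately show False using max[of "insert s T"] T by (simp add: P_def)
  qed
  then show ?thesis using T by (auto simp: P_def)
qed

text \<open>
  If a coefficient of \<open>f\<close> has value \<open>e < 0\<close>, a common denominator \<open>c ^ N\<close> of the coefficients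
  needs \<open>N (v c) \<ge> - e\<close>.  So no \<open>N\<close> points of \<open>S\<close> can have all their differences of value less
  than \<open>- e / N\<close>, once \<open>N\<close> exceeds the degree of \<open>f\<close>.
\<close>

lemma hull_net_of_nontrivial_Int:
  assumes S: "S \<subseteq> valuation_ring v" and f: "f \<in> Int_poly S (valuation_ring v)"
    and nf: "f \<notin> polys_over (valuation_ring v)"
  shows "\<exists>T (l :: 'g div_hull with_infty). finite T \<and> T \<subseteq> S \<and> l > 0 \<and>
           (\<forall>s\<in>S. \<exists>t\<in>T. map_with_infty to_hull (v (s - t)) \<ge> l)"
proof -
  obtain i where i: "coeff f i \<notin> valuation_ring v" using nf by (auto simp: polys_over_def)
  then obtain e where e: "v (coeff f i) = Fin e" "e < 0"
    by (cases "v (coeff f i)") (auto simp: valuation_ring_def zero_with_infty_def)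
  define N where "N = Suc (degree f)"
  define l where "l = Fin (hull_frac (- e) N)"
  have N: "0 < N" by (simp add: N_def)
  have l: "0 < l" using e N by (simp add: l_def zero_with_infty_def hull_frac_pos)
  have l_le: "l \<le> map_with_infty to_hull (Fin d) \<longleftrightarrow> - e \<le> nmul N d" for d
    using N by (simp add: l_def hull_frac_le_to_hull)
  define R where "R s t \<longleftrightarrow> l \<le> map_with_infty to_hull (v (s - t))" for s t
  have "\<exists>T. finite T \<and> T \<subseteq> S \<and> (\<forall>s\<in>S. \<exists>t\<in>T. R s t)"
  proof (rule finite_net_of_bounded_separated_sets)
    show "R s s" for s using valuation_zero[OF val] by (simp add: R_def)
    show "R t s" if "R s t" for s t
      using that valuation_minus_commute[OF val] by (simp add: R_def)
    show "card A < N" if A: "finite A" "A \<subseteq> S" "pairwise (\<lambda>a b. \<not> R a b) A" for A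
    proof (rule ccontr)
      assume "\<not> card A < N"
      then obtain B where B: "B \<subseteq> A" "card B = N" "finite B"
        using obtain_subset_with_card_n[of N A] by auto
      \<comment> \<open>a common denominator: the value of \<open>c\<close> is the largest one among the differences;
          the element 1 keeps \<open>D\<close> nonempty and the value of \<open>c\<close> nonnegative\<close>
      define D where "D = insert 1 {a - b | a b. a \<in> B \<and> b \<in> B \<and> a \<noteq> b}"
      have "D = insert 1 ((\<lambda>(a, b). a - b) ` {(a, b) \<in> B \<times> B. a \<noteq> b})" by (auto simp: D_def)
      moreover have "finite {(a, b) \<in> B \<times> B. a \<noteq> b}"
        by (rule finite_subset[of _ "B \<times> B"]) (use B in auto)
      ultimately have finD: "finite D" by simp
      then have "Max (v ` D) \<in> v ` D" by (intro Max_in) (auto simp: D_def)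
      then obtain c where c: "c \<in> D" "Max (v ` D) = v c" by auto
      have c_max: "v d \<le> v c" if "d \<in> D" for d using finD that c(2) Max_ge[of "v ` D"] by auto
      have c_ge0: "c \<in> valuation_ring v"
        using c_max[of 1] valuation_one[OF val] by (simp add: D_def valuation_ring_def)
      have c_small: "\<not> l \<le> map_with_infty to_hull (v c)"
      proof (cases "c = 1")
        case True
        then show ?thesis using l_le[of 0] e(2) valuation_one[OF val]
          by (simp add: zero_with_infty_def)
      next
        case False
        then obtain a b where "c = a - b" "a \<in> B" "b \<in> B" "a \<noteq> b" using c(1) by (auto simp: D_def)
        then show ?thesis using A(3) B(1) by (auto simp: pairwise_def R_def)
      qed
      then obtain d where d: "v c = Fin d" "nmul N d < - e"
        using l_le by (cases "v c") auto
      have "smult (c ^ card B) f \<in> polys_over (valuation_ring v)"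
      proof (rule interpolation_denominator)
        show "v (a - b) \<le> v c" if "a \<in> B" "b \<in> B" "a \<noteq> b" for a b
          using that by (intro c_max) (auto simp: D_def)
        show "poly f a \<in> valuation_ring v" if "a \<in> B" for a
          using that f B(1) A(2) by (auto simp: Int_poly_def)
        show "f = 0 \<or> degree f < card B" using B(2) by (simp add: N_def)
      qed (use A B S c_ge0 in auto)
      then have "c ^ N * coeff f i \<in> valuation_ring v" using B(2) by (simp add: polys_over_def)
      then have "0 \<le> nmul N d + e"
        by (simp add: valuation_ring_def val_mult val_power_Fin[OF d(1)] e(1) zero_with_infty_def)
      then show False using d(2) by (metis less_minus_iff add.commute add_less_same_cancel1
            add.right_inverse add_strict_right_mono not_le)
    qed
  qed
  then show ?thesis using l unfolding R_def by blast
qed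

lemma val_prod_ge:
  assumes "finite T" "\<And>t. t \<in> T \<Longrightarrow> 0 \<le> v (h t)" "t0 \<in> T"
  shows "v (h t0) \<le> v (\<Prod>t\<in>T. h t)"
proof -
  have "(\<Prod>t\<in>T - {t0}. h t) \<in> valuation_ring v"
    using assms(2) by (intro ring_prod) (simp add: valuation_ring_def)
  then have "v (h t0) \<le> v (h t0) + v (\<Prod>t\<in>T - {t0}. h t)"
    by (cases "v (h t0)"; cases "v (\<Prod>t\<in>T - {t0}. h t)")
      (auto simp: valuation_ring_def zero_with_infty_def)
  then show ?thesis using assms by (simp add: prod.remove val_mult)
qed

lemma nontrivial_Int_of_net:
  assumes nontriv: "valuation_ring v \<noteq> UNIV" and S: "S \<subseteq> valuation_ring v"
    and T: "finite T" "T \<subseteq> S" "0 < d" "\<forall>s\<in>S. \<exists>t\<in>T. d \<le> v (s - t)"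
  shows "Int_poly S (valuation_ring v) \<noteq> polys_over (valuation_ring v)"
proof -
  obtain x where x: "\<not> 0 \<le> v x" using nontriv by (auto simp: valuation_ring_def)
  obtain c where c: "c \<noteq> 0" "0 < v c" "v c \<le> d"
  proof (cases d)
    case Infty
    have x0: "x \<noteq> 0" using x valuation_zero[OF val] by auto
    have "0 < v (inverse x)"
      using x valuation_inverse[OF val x0]
      by (cases "v x"; cases "v (inverse x)")
        (auto simp: zero_with_infty_def add_eq_0_iff not_le)
    then show ?thesis using that[of "inverse x"] x0 Infty by simp
  next
    case (Fin g)
    obtain c where "v c = d" using val_surj by blast
    moreover from this have "c \<noteq> 0" using Fin valuation_zero[OF val] by auto
    ultimately show ?thesis using that[of c] T(3) by simp
  qed
  define f where "f = smult (inverse c) (\<Prod>t\<in>T. [:- t, 1:])"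
  have "poly f s \<in> valuation_ring v" if s: "s \<in> S" for s
  proof -
    obtain t0 where t0: "t0 \<in> T" "d \<le> v (s - t0)" using T(4) s by blast
    have "s - t \<in> valuation_ring v" if "t \<in> T" for t
      using that s S T(2) by (intro valuation_ring_subring[OF val]) auto
    then have "v (s - t0) \<le> v (\<Prod>t\<in>T. s - t)"
      using T(1) t0(1) by (intro val_prod_ge) (auto simp: valuation_ring_def)
    then have "v c \<le> v (\<Prod>t\<in>T. s - t)" using c(3) t0(2) by (meson order_trans)
    then have "(\<Prod>t\<in>T. s - t) / c \<in> valuation_ring v" using c(1) by (intro val_divide_in_ring)
    moreover have "poly f s = (\<Prod>t\<in>T. s - t) / c"
      by (simp add: f_def poly_prod divide_inverse mult.commute)
    ultimately show ?thesis by simp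
  qed
  then have "f \<in> Int_poly S (valuation_ring v)" by (simp add: Int_poly_def)
  moreover have "f \<notin> polys_over (valuation_ring v)"
  proof
    assume "f \<in> polys_over (valuation_ring v)"
    then have "lead_coeff f \<in> valuation_ring v" by (simp add: polys_over_def)
    moreover have "lead_coeff f = inverse c"
      by (simp only: f_def lead_coeff_smult lead_coeff_prod) simp
    ultimately have "0 \<le> v (inverse c)" by (simp add: valuation_ring_def)
    then show False using c(2) valuation_inverse[OF val c(1)]
      by (cases "v c"; cases "v (inverse c)")
        (auto simp: zero_with_infty_def add_eq_0_iff)
  qed
  ultimately show ?thesis by blast
qed

lemma finite_residue_classes_iff_net:
  "(\<exists>b\<in>maximal_ideal v. finite (residue_classes S b (valuation_ring v))) \<longleftrightarrow>
     (\<exists>T d. finite T \<and> T \<subseteq> S \<and> d > 0 \<and> (\<forall>s\<in>S. \<exists>t\<in>T. v (s - t) \<ge> d))"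
proof -
  define cl where "cl b s = {s + b * x | x. x \<in> valuation_ring v}" for b s
  have classes: "residue_classes S b (valuation_ring v) = cl b ` S" for b
    by (auto simp: residue_classes_def cl_def)
  have sub: "cl b s \<subseteq> cl b t" if "v b \<le> v (s - t)" for b s t
  proof -
    obtain y where y: "y \<in> valuation_ring v" "s = t + b * y"
    proof (cases "b = 0")
      case True
      then have "v (s - t) = Infty" using \<open>v b \<le> v (s - t)\<close> valuation_zero[OF val]
        by (cases "v (s - t)") auto
      then show ?thesis using True that[of 0] ring_zero val_eq_Infty_iff by auto
    next
      case False
      then show ?thesis using that[of "(s - t) / b"] val_divide_in_ring \<open>v b \<le> v (s - t)\<close> by simp
    qed
    show ?thesis
    proof
      fix z assume "z \<in> cl b s"
      then obtain x where "x \<in> valuation_ring v" "z = s + b * x" by (auto simp: cl_def)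
      then show "z \<in> cl b t" using y unfolding cl_def
        by (auto simp: algebra_simps intro!: exI[of _ "x + y"] ring_add)
    qed
  qed
  show ?thesis
  proof
    assume "\<exists>b\<in>maximal_ideal v. finite (residue_classes S b (valuation_ring v))"
    then obtain b where b: "0 < v b" "finite (cl b ` S)"
      by (auto simp: classes maximal_ideal_def)
    then obtain T where T: "T \<subseteq> S" "finite T" "cl b ` S = cl b ` T"
      using finite_subset_image[of "cl b ` S" "cl b" S] by auto
    have "\<exists>t\<in>T. v b \<le> v (s - t)" if s: "s \<in> S" for s
    proof -
      obtain t where t: "t \<in> T" "cl b s = cl b t" 
        using imageI[OF s, of "cl b"] unfolding T(3) by blast
      have "s \<in> cl b s" using ring_zero by (auto simp: cl_def)
      then have "s \<in> cl b t" by (simp only: t(2))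
      then obtain x where "x \<in> valuation_ring v" "s = t + b * x" unfolding cl_def by blast
      then have "v b \<le> v (s - t)"
        by (cases "v b"; cases "v x") (auto simp: val_mult valuation_ring_def zero_with_infty_def)
      then show ?thesis using t(1) by blast
    qed
    then show "\<exists>T d. finite T \<and> T \<subseteq> S \<and> d > 0 \<and> (\<forall>s\<in>S. \<exists>t\<in>T. v (s - t) \<ge> d)"
      using T b(1) by blast
  next
    assume "\<exists>T d. finite T \<and> T \<subseteq> S \<and> d > 0 \<and> (\<forall>s\<in>S. \<exists>t\<in>T. v (s - t) \<ge> d)"
    then obtain T d where T: "finite T" "T \<subseteq> S" "0 < d" "\<forall>s\<in>S. \<exists>t\<in>T. d \<le> v (s - t)" by blast
    obtain b where b: "v b = d" using val_surj by blast
    have "cl b s \<in> cl b ` T" if "s \<in> S" for s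
    proof -
      obtain t where t: "t \<in> T" "v b \<le> v (s - t)" using T(4) \<open>s \<in> S\<close> b by blast
      then have "cl b s = cl b t"
        using sub[of b s t] sub[of b t s] valuation_minus_commute[OF val, of s t] by auto
      then show ?thesis using t(1) by simp
    qed
    then have "finite (cl b ` S)" by (intro finite_subset[OF _ finite_imageI[OF T(1)]]) auto
    then show "\<exists>b\<in>maximal_ideal v. finite (residue_classes S b (valuation_ring v))"
      using T(3) b by (auto simp: classes maximal_ideal_def)
  qed
qed


section \<open>A finite net excludes the sequences\<close>

lemma infinite_of_no_last:
  assumes r: "Well_order r" and "a \<in> A" and step: "\<And>a. a \<in> A \<Longrightarrow> \<exists>b\<in>A. index_less r a b"
  shows "infinite A"
proof
  assume "finite A"
  have tr: "trans r" and an: "antisym r"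
    using r by (auto simp: order_on_defs)
  have "\<exists>m\<in>A. \<forall>x\<in>A. x \<noteq> m \<longrightarrow> \<not> index_less r m x"
  proof (rule Finite_Set.bex_max_element[OF \<open>finite A\<close>])
    show "asymp_on A (index_less r)"
      using an by (auto simp: asymp_on_def index_less_def antisym_def)
    show "transp_on A (index_less r)"
      using tr an by (auto simp: transp_on_def index_less_def trans_def antisym_def)
  qed (use \<open>a \<in> A\<close> in auto)
  then show False using step unfolding index_less_def by metis
qed

lemma no_infinite_separated_family:
  assumes T: "finite T" "\<forall>s\<in>S. \<exists>t\<in>T. d \<le> v (s - t)"
    and A: "infinite A" "s ` A \<subseteq> S"
  shows "\<exists>i\<in>A. \<exists>j\<in>A. i \<noteq> j \<and> d \<le> v (s i - s j)"
proof -
  have "\<forall>i\<in>A. \<exists>t\<in>T. d \<le> v (s i - t)" using T(2) A(2) by auto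
  then obtain h where h: "\<And>i. i \<in> A \<Longrightarrow> h i \<in> T \<and> d \<le> v (s i - h i)" by metis
  have "\<not> inj_on h A"
  proof
    assume "inj_on h A"
    moreover have "h ` A \<subseteq> T" using h by auto
    ultimately show False using A(1) T(1) by (meson finite_subset finite_imageD)
  qed
  then obtain i j where ij: "i \<in> A" "j \<in> A" "i \<noteq> j" "h i = h j" by (auto simp: inj_on_def)
  then have "d \<le> v (s i - h i)" "d \<le> v (h i - s j)"
    using h[of i] h[of j] valuation_minus_commute[OF val, of "s j"] by auto
  then have "d \<le> v (s i - s j)" by (rule val_diff_trans)
  then show ?thesis using ij by blast
qed

text \<open>
  As the breadth is the whole maximal ideal, the gauges drop below \<open>d\<close> at some index.  The
  tail from there on is infinite because there is no last index, and no two of its members can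
  be \<open>d\<close>-close to the same point of the net.
\<close>

lemma no_divergent_of_net:
  assumes T: "finite T" "0 < d" "\<forall>s\<in>S. \<exists>t\<in>T. d \<le> v (s - t)"
  shows "\<not> contains_divergent v S (maximal_ideal v)"
proof
  assume "contains_divergent v S (maximal_ideal v)"
  then obtain r :: "'k rel" and s where E: "pseudo_divergent v r s" and S: "s ` Field r \<subseteq> S"
    and Br: "breadth_divergent v r s = maximal_ideal v"
    by (auto simp: contains_divergent_def)
  have wo: "Well_order r" using E by (simp add: pseudo_divergent_def)
  obtain b where "v b = d" using val_surj by blast
  then have "b \<in> breadth_divergent v r s" using Br T(2) by (simp add: maximal_ideal_def)
  then obtain i j where ij: "index_less r j i" "v (s i - s j) < d"
    using \<open>v b = d\<close> by (auto simp: breadth_divergent_def)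
  \<comment> \<open>beyond \<open>i\<close>, all differences have value less than \<open>d\<close>\<close>
  define A where "A = {k. index_less r i k}"
  have trans: "index_less r a c" if "index_less r a b" "index_less r b c" for a b c
    using that wo by (auto simp: index_less_def order_on_defs trans_def antisym_def)
  have close: "v (s k - s m) < d" if "k \<in> A" "index_less r k m" for k m
  proof -
    have "v (s i - s k) < v (s j - s i)" "v (s k - s m) < v (s i - s k)"
      using E ij(1) that unfolding A_def pseudo_divergent_def by auto
    then show ?thesis using ij(2) valuation_minus_commute[OF val, of "s i" "s j"] by simp
  qed
  have succ: "\<exists>m\<in>A. index_less r k m" if "index_less r i k \<or> k = i" for k
  proof -
    have "k \<in> Field r" using that ij(1) by (auto dest: index_lessD)
    then obtain m where "index_less r k m" using E unfolding pseudo_divergent_def by blast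
    then show ?thesis using that trans by (auto simp: A_def)
  qed
  obtain a where "a \<in> A" using succ by blast
  then have "infinite A" 
    by (rule infinite_of_no_last[OF wo]) (use succ in \<open>simp add: A_def\<close>)
  moreover have AF: "A \<subseteq> Field r" by (auto simp: A_def dest: index_lessD)
  ultimately obtain k m where km: "k \<in> A" "m \<in> A" "k \<noteq> m" "d \<le> v (s k - s m)"
    using no_infinite_separated_family[OF T(1,3)] S by (metis image_mono order_trans)
  then have "index_less r k m \<or> index_less r m k"
    using Well_order_trichotomy[OF wo] AF by blast
  then show False
    using km close valuation_minus_commute[OF val, of "s k" "s m"] by (metis not_le)
qed

lemma no_stationary_of_net:
  assumes T: "finite T" "0 < d" "\<forall>s\<in>S. \<exists>t\<in>T. d \<le> v (s - t)"
  shows "\<not> contains_stationary v S (valuation_ring v)"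
proof
  assume "contains_stationary v S (valuation_ring v)"
  then obtain r :: "'k rel" and s where E: "pseudo_stationary v r s" and S: "s ` Field r \<subseteq> S"
    and Br: "breadth_stationary v r s = valuation_ring v"
    by (auto simp: contains_stationary_def)
  have "infinite (Field r)" using E by (simp add: pseudo_stationary_def)
  then obtain i j where ij: "i \<in> Field r" "j \<in> Field r" "i \<noteq> j" "d \<le> v (s i - s j)"
    using no_infinite_separated_family[OF T(1,3) _ S] by blast
  have "1 \<in> breadth_stationary v r s" unfolding Br by (rule valuation_ring_subring[OF val])
  then obtain k l where kl: "k \<in> Field r" "l \<in> Field r" "k \<noteq> l" "v (s k - s l) \<le> 0"
    using valuation_one[OF val] by (auto simp: breadth_stationary_def)
  have "v (s i - s j) = v (s k - s l)" using E ij kl unfolding pseudo_stationary_def by blast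
  then show False using ij(4) kl(4) T(2) by simp
qed


section \<open>Sequences in the absence of finite nets\<close>

text \<open>
  The sequence is indexed by a complete set of representatives modulo the maximal ideal, with
  an arbitrary well-order.
\<close>

lemma contains_stationary_of_infinite_residues:
  assumes S: "S \<subseteq> valuation_ring v"
    and inf: "\<And>T. finite T \<Longrightarrow> T \<subseteq> S \<Longrightarrow> \<exists>s\<in>S. \<forall>t\<in>T. \<not> 0 < v (s - t)"
  shows "contains_stationary v S (valuation_ring v)"
proof -
  define rep where "rep s = (SOME t. t \<in> S \<and> 0 < v (s - t))" for s
  have rep: "rep s \<in> S \<and> 0 < v (s - rep s)" if "s \<in> S" for s
    unfolding rep_def
    by (rule someI[of _ s]) (use that valuation_zero[OF val] in \<open>simp add: zero_with_infty_def\<close>)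
  define A where "A = rep ` S"
  have AS: "A \<subseteq> S" using rep by (auto simp: A_def)
  have infA: "infinite A" using inf[of A] AS rep by (auto simp: A_def)
  have zero: "v (a - b) = 0" if ab: "a \<in> A" "b \<in> A" "a \<noteq> b" for a b
  proof (rule antisym)
    show "0 \<le> v (a - b)" using valuation_ring_subring(2)[OF val, of a b] ab AS S
      by (auto simp: valuation_ring_def)
    show "v (a - b) \<le> 0"
    proof (rule ccontr)
      assume "\<not> v (a - b) \<le> 0"
      then have close: "0 < v (a - b)" by simp
      obtain s t where st: "s \<in> S" "t \<in> S" "a = rep s" "b = rep t" using ab by (auto simp: A_def)
      have "0 < v (s - b)" using val_diff_trans_less[OF _ close, of s] rep[of s] st by auto
      then have *: "0 < v (s - t)"
        using val_diff_trans_less[of 0 s b t] rep[of t] st valuation_minus_commute[OF val, of t] by auto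
      have "0 < v (s - u) \<longleftrightarrow> 0 < v (t - u)" for u
        using val_diff_trans_less[of 0 s t u] val_diff_trans_less[of 0 t s u] *
          valuation_minus_commute[OF val, of s t] by auto
      then show False using ab(3) st by (simp add: rep_def)
    qed
  qed
  obtain r where r: "well_order_on A r" using well_order_on by blast
  then have F: "Field r = A" and wo: "Well_order r" using well_order_on_Field by auto
  have "pseudo_stationary v r id"
    using zero wo infA by (simp add: pseudo_stationary_def F zero_with_infty_def)
  moreover have "id ` Field r \<subseteq> S" using AS F by simp
  moreover have "breadth_stationary v r id = valuation_ring v"
  proof -
    obtain a where "a \<in> A" using infA by (metis finite.emptyI ex_in_conv)
    moreover obtain b where "b \<in> A - {a}" using infA by (metis ex_in_conv finite.emptyI infinite_remove)
    ultimately show ?thesis using zero unfolding breadth_stationary_def F valuation_ring_def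
      by (auto, metis)
  qed
  ultimately show ?thesis using contains_stationaryI[OF val, of r id S] by simp
qed

text \<open>
  Well-order the field and keep those elements \<open>s\<close> of \<open>S\<close> with \<open>v (s - t) > 0\<close> for which \<open>v (s - t)\<close> is smaller than for all
  earlier such elements.  Along these records \<open>v (s - t)\<close> decreases, so that the value of the difference of
  two of them is that of the later one; and each \<open>v (s - t)\<close> is undercut by a record,
  namely by the first element whose value is at most \<open>v (s - t)\<close>.
\<close>

lemma contains_divergent_of_values_near_zero:
  assumes near: "\<And>d. 0 < d \<Longrightarrow> \<exists>s\<in>S. 0 < v (s - t) \<and> v (s - t) < d"
  shows "contains_divergent v S (maximal_ideal v)"
proof -
  obtain w :: "'k rel" where w: "well_order_on UNIV w" using well_order_on by blast
  have FU: "Field w = UNIV" and wow: "Well_order w" using well_order_on_Field[OF w] w by auto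
  define U where "U = {s \<in> S. 0 < v (s - t)}"
  define C where "C = {s \<in> U. \<forall>e\<in>U. index_less w e s \<longrightarrow> v (s - t) < v (e - t)}"
  have undercut: "\<exists>c\<in>C. v (c - t) \<le> v (s - t)" if "s \<in> U" for s
  proof -
    define L where "L = {c \<in> U. v (c - t) \<le> v (s - t)}"
    have "\<exists>m\<in>L. \<forall>x\<in>L. (m, x) \<in> w"
    proof -
      have "L \<noteq> {}" "L \<subseteq> Field w" using that FU by (auto simp: L_def)
      then show ?thesis 
        using wow Linear_order_Well_order_iff[of w] by (simp add: well_order_on_def)
    qed
    then obtain c where c: "c \<in> L" "\<And>x. x \<in> L \<Longrightarrow> (c, x) \<in> w" by blast
    have "v (c - t) < v (e - t)" if "e \<in> U" "index_less w e c" for e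
    proof (rule ccontr)
      assume "\<not> v (c - t) < v (e - t)"
      then have "e \<in> L" using that(1) c(1) by (auto simp: L_def)
      then have "(c, e) \<in> w" by (rule c(2))
      then show False using that(2) wow by (auto simp: index_less_def order_on_defs antisym_def)
    qed
    then show ?thesis using c(1) by (auto simp: C_def L_def)
  qed
  have small: "\<exists>c\<in>C. v (c - t) < d" if d: "0 < d" for d
  proof -
    obtain s where "s \<in> U" "v (s - t) < d" using near[OF d] by (auto simp: U_def)
    then show ?thesis using undercut order_le_less_trans by blast
  qed
  define r where "r = Restr w C"
  have F: "Field r = C"
    unfolding r_def using wow FU by (simp add: Refl_Field_Restr2 order_on_defs)
  have wo: "Well_order r" unfolding r_def using wow by (rule Well_order_Restr)
  have decr: "v (j - t) < v (i - t)" if "index_less r i j" for i j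
    using that by (auto simp: C_def r_def index_less_def)
  have diff: "v (i - j) = v (j - t)" if "index_less r i j" for i j
  proof -
    have "v (t - j) < v (i - t)" using decr[OF that] valuation_minus_commute[OF val, of t j] by simp
    then have "v ((i - t) + (t - j)) = v (t - j)" by (rule valuation_add_larger[OF val])
    then show ?thesis using valuation_minus_commute[OF val, of t j] by simp
  qed
  have succ: "\<exists>j\<in>C. index_less r i j" if "i \<in> C" for i
  proof -
    have "0 < v (i - t)" using that by (simp add: C_def U_def)
    then obtain j where j: "j \<in> C" "v (j - t) < v (i - t)" using small by blast
    then have "index_less r i j \<or> index_less r j i"
      using that by (intro Well_order_trichotomy[OF wo]) (auto simp: F)
    then show ?thesis using j decr[of j i] by auto
  qed
  obtain c0 where c0: "c0 \<in> C" using small[of Infty] by (auto simp: zero_with_infty_def)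
  have "pseudo_divergent v r id"
    unfolding pseudo_divergent_def
  proof (intro conjI wo ballI allI impI)
    show "infinite (Field r)" unfolding F using infinite_of_no_last[OF wo c0] succ by blast
    show "\<exists>j. index_less r i j" if "i \<in> Field r" for i using succ that by (auto simp: F)
    show "v (id j - id k) < v (id i - id j)" if "index_less r i j \<and> index_less r j k" for i j k
      using that diff[of i j] diff[of j k] decr[of j k] by simp
  qed
  moreover have "id ` Field r \<subseteq> S" by (auto simp: F C_def U_def)
  moreover have "breadth_divergent v r id = maximal_ideal v"
  proof (intro equalityI subsetI)
    fix x assume "x \<in> breadth_divergent v r id"
    then obtain i j where ij: "index_less r j i" "v (i - j) < v x"
      by (auto simp: breadth_divergent_def)
    have "i \<in> C" using ij(1) F by (auto dest: index_lessD)
    then have "0 < v (i - t)" by (simp add: C_def U_def)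
    also have "\<dots> < v x"
      using ij diff[OF ij(1)] valuation_minus_commute[OF val, of i j] by simp
    finally show "x \<in> maximal_ideal v" by (simp add: maximal_ideal_def)
  next
    fix x assume "x \<in> maximal_ideal v"
    then have "0 < v x" by (simp add: maximal_ideal_def)
    then obtain c where c: "c \<in> C" "v (c - t) < v x" using small by blast
    \<comment> \<open>\<open>c\<close> could be the first index, which has no gauge; its successors do\<close>
    obtain i where i: "index_less r c i" using succ c(1) by blast
    have "v (i - c) < v x"
      using diff[OF i] decr[OF i] c(2) valuation_minus_commute[OF val, of i c] by simp
    then show "x \<in> breadth_divergent v r id" using i by (auto simp: breadth_divergent_def)
  qed
  ultimately show ?thesis using contains_divergentI[OF val, of r id S] by simp
qed

text \<open>
  Finitely many classes \<open>t + M\<close> cover \<open>S\<close>, and within each of them the values \<open>v (s - t)\<close> are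
  bounded away from \<open>0\<close>; the least of these finitely many bounds works for all of \<open>S\<close>.
\<close>

lemma net_of_no_sequences:
  assumes S: "S \<subseteq> valuation_ring v"
    and nodiv: "\<not> contains_divergent v S (maximal_ideal v)"
    and nostat: "\<not> contains_stationary v S (valuation_ring v)"
  shows "\<exists>T d. finite T \<and> T \<subseteq> S \<and> d > 0 \<and> (\<forall>s\<in>S. \<exists>t\<in>T. v (s - t) \<ge> d)"
proof -
  have "\<exists>T. finite T \<and> T \<subseteq> S \<and> (\<forall>s\<in>S. \<exists>t\<in>T. 0 < v (s - t))"
  proof (rule ccontr)
    assume *: "\<not> ?thesis"
    have "contains_stationary v S (valuation_ring v)"
      using S
    proof (rule contains_stationary_of_infinite_residues)
      show "\<exists>s\<in>S. \<forall>t\<in>T. \<not> 0 < v (s - t)" if "finite T" "T \<subseteq> S" for T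
      proof -
        have "\<not> (\<forall>s\<in>S. \<exists>t\<in>T. 0 < v (s - t))" using * that by simp
        then show ?thesis by simp
      qed
    qed
    then show False using nostat by contradiction
  qed
  then obtain T where T: "finite T" "T \<subseteq> S" "\<forall>s\<in>S. \<exists>t\<in>T. 0 < v (s - t)"
    by blast
  have "\<forall>t. \<exists>d>0. \<forall>s\<in>S. 0 < v (s - t) \<longrightarrow> d \<le> v (s - t)"
  proof
    fix t
    show "\<exists>d>0. \<forall>s\<in>S. 0 < v (s - t) \<longrightarrow> d \<le> v (s - t)"
    proof (rule ccontr)
      assume "\<not> (\<exists>d>0. \<forall>s\<in>S. 0 < v (s - t) \<longrightarrow> d \<le> v (s - t))"
      then have "\<exists>s\<in>S. 0 < v (s - t) \<and> v (s - t) < d" if "0 < d" for d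
        using that by (auto simp: not_le)
      then have "contains_divergent v S (maximal_ideal v)"
        by (rule contains_divergent_of_values_near_zero)
      then show False using nodiv by contradiction
    qed
  qed
  then obtain g where g: "\<And>t. 0 < g t" "\<And>t s. s \<in> S \<Longrightarrow> 0 < v (s - t) \<Longrightarrow> g t \<le> v (s - t)"
    by metis
  \<comment> \<open>\<open>Infty\<close> takes care of the case that \<open>T\<close> is empty\<close>
  define d where "d = Min (insert Infty (g ` T))"
  have "0 < d" using T(1) g(1) by (simp add: d_def zero_with_infty_def)
  moreover have "\<exists>t\<in>T. d \<le> v (s - t)" if s: "s \<in> S" for s
  proof -
    obtain t where t: "t \<in> T" "0 < v (s - t)" using T(3) s by blast
    have "d \<le> g t" using T(1) t(1) by (auto simp: d_def intro: Min_le)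
    then show ?thesis using g(2)[OF s t(2)] t(1) by (meson order_trans)
  qed
  ultimately show ?thesis using T by blast
qed

end


section \<open>The equivalence\<close>

theorem theorem2p7:
  fixes v :: "'k::field \<Rightarrow> 'g::linordered_ab_group_add with_infty"
    and V M S :: "'k set"
  assumes "valuation v"
    and "V = valuation_ring v"
    and "M = maximal_ideal v"
    and "V \<noteq> UNIV"
    and "S \<subseteq> V"
  shows
    "let
       P1 = (Int_poly S V \<noteq> polys_over V);
       P2 = (\<exists>T (l :: 'g div_hull with_infty). finite T \<and> T \<subseteq> S \<and> l > 0 \<and>
               (\<forall>s\<in>S. \<exists>t\<in>T. map_with_infty to_hull (v (s - t)) \<ge> l));
       P3 = (\<exists>T (d :: 'g with_infty). finite T \<and> T \<subseteq> S \<and> d > 0 \<and>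
               (\<forall>s\<in>S. \<exists>t\<in>T. v (s - t) \<ge> d));
       P4 = (\<exists>b\<in>M. finite (residue_classes S b V));
       P5 = (\<not> contains_divergent v S M \<and> \<not> contains_stationary v S V)
     in (P1 \<longleftrightarrow> P2) \<and> (P2 \<longleftrightarrow> P3) \<and> (P3 \<longleftrightarrow> P4) \<and> (P4 \<longleftrightarrow> P5)"
proof -
  note val = assms(1)
  define P1 where "P1 = (Int_poly S V \<noteq> polys_over V)"
  define P2 where "P2 = (\<exists>T (l :: 'g div_hull with_infty). finite T \<and> T \<subseteq> S \<and> l > 0 \<and>
               (\<forall>s\<in>S. \<exists>t\<in>T. map_with_infty to_hull (v (s - t)) \<ge> l))"
  define P3 where "P3 = (\<exists>T (d :: 'g with_infty). finite T \<and> T \<subseteq> S \<and> d > 0 \<and>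
               (\<forall>s\<in>S. \<exists>t\<in>T. v (s - t) \<ge> d))"
  define P4 where "P4 = (\<exists>b\<in>M. finite (residue_classes S b V))"
  define P5 where "P5 = (\<not> contains_divergent v S M \<and> \<not> contains_stationary v S V)"
  have S: "S \<subseteq> valuation_ring v" using assms(2,5) by simp
  have 12: P2 if P1
  proof -
    have "polys_over V \<subseteq> Int_poly S V"
      using polys_over_eval[OF val] S assms(2) by (auto simp: Int_poly_def)
    then obtain f where "f \<in> Int_poly S V" "f \<notin> polys_over V" using \<open>P1\<close> by (auto simp: P1_def)
    then show P2 unfolding P2_def assms(2) using hull_net_of_nontrivial_Int[OF val S] by blast
  qed
  have 23: P3 if p2: P2
  proof -
    obtain T :: "'k set" and l :: "'g div_hull with_infty" where T: "finite T" "T \<subseteq> S" "0 < l"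
      "\<forall>s\<in>S. \<exists>t\<in>T. l \<le> map_with_infty to_hull (v (s - t))"
      using p2 unfolding P2_def by blast
    obtain d :: "'g with_infty" where d: "0 < d"
      "\<And>x. l \<le> map_with_infty to_hull x \<Longrightarrow> d \<le> x"
      using hull_threshold[OF T(3)] by blast
    have "\<forall>s\<in>S. \<exists>t\<in>T. d \<le> v (s - t)" using T(4) d(2) by meson
    then show P3 unfolding P3_def using T(1,2) d(1) by blast
  qed
  have 31: P1 if P3
  proof -
    obtain T :: "'k set" and d :: "'g with_infty" where "finite T" "T \<subseteq> S" "0 < d"
      "\<forall>s\<in>S. \<exists>t\<in>T. d \<le> v (s - t)"
      using \<open>P3\<close> unfolding P3_def by blast
    then show P1
      using nontrivial_Int_of_net[OF val _ S] assms(2,4) unfolding P1_def by simp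
  qed
  have 34: "P3 \<longleftrightarrow> P4"
    unfolding P3_def P4_def assms(2,3) using finite_residue_classes_iff_net[OF val] by blast
  have 35: "P3 \<longleftrightarrow> P5"
  proof
    assume P3
    then obtain T :: "'k set" and d :: "'g with_infty" where "finite T" "0 < d"
      "\<forall>s\<in>S. \<exists>t\<in>T. d \<le> v (s - t)"
      unfolding P3_def by blast
    then show P5
      unfolding P5_def assms(2,3)
      using no_divergent_of_net[OF val] no_stationary_of_net[OF val] by simp
  next
    assume P5
    then show P3
      unfolding P3_def P5_def assms(2,3) by (intro net_of_no_sequences[OF val S]) simp_all
  qed
  have "(P1 \<longleftrightarrow> P2) \<and> (P2 \<longleftrightarrow> P3) \<and> (P3 \<longleftrightarrow> P4) \<and> (P4 \<longleftrightarrow> P5)"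
    using 12 23 31 34 35 by blast
  then show ?thesis
    unfolding Let_def P1_def P2_def P3_def P4_def P5_def .
qed

end
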